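(* Let $\ell$ be an odd prime, $n$ a positive integer, and $t$ an integer with $t\not\equiv 0\pmod{\ell}$ and $t\not\equiv\pm 2\pmod{\ell}$. Write $$T_\ell^n(x)-t=\sum_{i=0}^{\ell^n}b_i\,(x-t)^i,\qquad b_i\in\mathbb{Z}.$$ If $m\ge 0$ and $i$ are integers with $\ell^m\le i<\ell^{m+1}\le\ell^n$, then $\nu_\ell(b_i)\ge n-m$, with equality if $i=\ell^m$.
   Context: $T_d(x)$ is the Chebyshev polynomial of the first kind of degree $d$ (the unique monic polynomial with $T_d(z+z^{-1})=z^d+z^{-d}$; it has integer coefficients), and $T_\ell^n$ denotes the $n$-fold composition of $T_\ell$. $\nu_\ell$ is the $\ell$-adic valuation. Explicitly, for $1\le i\le\ell^n$, $b_i=\ell^n\sum_{k=0}^{\lfloor(\ell^n-i)/2\rfloor}(-1)^k\binom{\ell^n-k}{k}\binom{\ell^n-2k}{i}\frac{t^{\ell^n-2k-i}}{\ell^n-k}$. *)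

theory Defs
  imports "HOL-Computational_Algebra.Computational_Algebra"
    "HOL-Library.Extended_Nat" "HOL-Number_Theory.Cong"
begin

(* In degree 0 no monic polynomial satisfies the identity, because z^0 + 1/z^0 = 2; so
   chebyshev d is meaningful only for d >= 1, where lemma ex1_chebyshev applies. *)
definition is_chebyshev :: "nat \<Rightarrow> int poly \<Rightarrow> bool" where
  "is_chebyshev d p \<longleftrightarrow> lead_coeff p = 1 \<and>
     (\<forall>z::complex. z \<noteq> 0 \<longrightarrow> poly (map_poly of_int p) (z + inverse z) = z ^ d + inverse z ^ d)"

definition chebyshev :: "nat \<Rightarrow> int poly" where
  "chebyshev d = (THE p. is_chebyshev d p)"

definition poly_iterate :: "nat \<Rightarrow> 'a::comm_semiring_1 poly \<Rightarrow> 'a poly" where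
  "poly_iterate n p = ((\<lambda>q. pcompose p q) ^^ n) [:0, 1:]"

(* The library's multiplicity sends 0 to 0, whereas the valuation of 0 is infinite. *)
definition valuation :: "nat \<Rightarrow> int \<Rightarrow> enat" where
  "valuation l x = (if x = 0 then \<infinity> else enat (multiplicity (int l) x))"

fun chebyshev_rec :: "nat \<Rightarrow> int poly" where
  "chebyshev_rec 0 = [:2:]"
| "chebyshev_rec (Suc 0) = [:0, 1:]"
| "chebyshev_rec (Suc (Suc d)) = pCons 0 (chebyshev_rec (Suc d)) - chebyshev_rec d"

lemma chebyshev_rec_degree:
  "degree (chebyshev_rec d) = d \<and> coeff (chebyshev_rec d) d = (if d = 0 then 2 else 1)"
proof (induction d rule: chebyshev_rec.induct)
  case (3 d)
  let ?p = "pCons 0 (chebyshev_rec (Suc d))" and ?q = "chebyshev_rec d"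
  have nz: "chebyshev_rec (Suc d) \<noteq> 0" using 3 by auto
  have dp: "degree ?p = Suc (Suc d)" using 3 nz by simp
  have dq: "degree ?q < Suc (Suc d)" using 3 by simp
  have "degree (?p + - ?q) = degree ?p"
    by (rule degree_add_eq_left) (use dp dq in simp)
  moreover have "coeff ?q (Suc (Suc d)) = 0" using dq by (rule coeff_eq_0)
  ultimately show ?case using dp 3 by simp
qed auto

lemma chebyshev_rec_eval:
  fixes z :: complex
  assumes "z \<noteq> 0"
  shows "poly (map_poly of_int (chebyshev_rec d)) (z + inverse z) = z ^ d + inverse z ^ d"
proof (induction d rule: chebyshev_rec.induct)
  case (3 d)
  have "map_poly of_int (chebyshev_rec (Suc (Suc d))) =
    (pCons 0 (map_poly of_int (chebyshev_rec (Suc d))) - map_poly of_int (chebyshev_rec d) :: complex poly)"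
    by (rule poly_eqI) (simp add: coeff_map_poly coeff_pCons split: nat.split)
  then have "poly (map_poly of_int (chebyshev_rec (Suc (Suc d)))) (z + inverse z) =
    (z + inverse z) * (z ^ Suc d + inverse z ^ Suc d) - (z ^ d + inverse z ^ d)"
    using 3 by simp
  also have "\<dots> = z ^ Suc (Suc d) + inverse z ^ Suc (Suc d)"
    using assms by (simp add: field_simps)
  finally show ?case .
qed (simp_all add: map_poly_pCons)

lemma is_chebyshev_unique:
  assumes "is_chebyshev d p" "is_chebyshev d q"
  shows "p = q"
proof -
  have "poly (map_poly of_int p) w = poly (map_poly of_int q) w" for w :: complex
  proof -
    define s where "s = csqrt (w\<^sup>2 - 4)"
    define z where "z = w / 2 + s / 2"
    have "s * s = w * w - 4"
      using power2_csqrt[of "w\<^sup>2 - 4"] by (simp only: s_def power2_eq_square)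
    moreover have "4 * (z * (w - z)) = w * w - s * s"
      unfolding z_def by (simp add: algebra_simps)
    ultimately have q: "z * (w - z) = 1" by simp
    then have "z \<noteq> 0" by auto
    moreover have "w = z + inverse z"
      unfolding inverse_unique[OF q] by simp
    ultimately show ?thesis using assms unfolding is_chebyshev_def by metis
  qed
  then have "map_poly of_int p = (map_poly of_int q :: complex poly)"
    using poly_eq_poly_eq_iff by blast
  then have "complex_of_int (coeff p i) = of_int (coeff q i)" for i
    by (metis coeff_map_poly of_int_0)
  then show ?thesis by (intro poly_eqI) simp
qed

lemma is_chebyshev_rec: "d \<ge> 1 \<Longrightarrow> is_chebyshev d (chebyshev_rec d)"
  using chebyshev_rec_degree[of d] chebyshev_rec_eval[of _ d] by (auto simp: is_chebyshev_def)

lemma ex1_chebyshev: "d \<ge> 1 \<Longrightarrow> \<exists>!p. is_chebyshev d p"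
  using is_chebyshev_rec is_chebyshev_unique by blast

lemma chebyshev_eq_rec: "d \<ge> 1 \<Longrightarrow> chebyshev d = chebyshev_rec d"
  unfolding chebyshev_def using is_chebyshev_rec is_chebyshev_unique by blast

lemma degree_poly_iterate:
  fixes p :: "'a::idom poly"
  shows "degree (poly_iterate n p) = degree p ^ n"
  by (induction n) (simp_all add: poly_iterate_def degree_pcompose)

(* The integral expansion in powers of x - t exists and is unique. *)
lemma expansion_iff:
  fixes p :: "int poly" and t :: int and b :: "nat \<Rightarrow> int"
  assumes "degree p \<le> N"
  shows "p = (\<Sum>i\<le>N. smult (b i) ([:- t, 1:] ^ i)) \<longleftrightarrow>
    (\<forall>i\<le>N. b i = coeff (pcompose p [:t, 1:]) i)"
proof -
  have s1: "pcompose [:- t, 1:] [:t, 1:] = [:0, 1:]" and s2: "pcompose [:t, 1:] [:- t, 1:] = [:0, 1:]"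
    by (simp_all add: pcompose_pCons)
  have inj: "p = q \<longleftrightarrow> pcompose p [:t, 1:] = pcompose q [:t, 1:]" for p q
    by (metis pcompose_assoc pcompose_idR s2)
  have pw: "pcompose ([:- t, 1:] ^ i) [:t, 1:] = [:0, 1:] ^ i" for i
  proof (induction i)
    case (Suc i)
    then show ?case by (simp only: power_Suc pcompose_mult s1)
  qed (simp add: pcompose_1)
  have shift: "pcompose (\<Sum>i\<le>N. smult (b i) ([:- t, 1:] ^ i)) [:t, 1:] = (\<Sum>i\<le>N. monom (b i) i)"
    by (simp add: pcompose_sum pcompose_smult pw monom_altdef)
  have cf: "coeff (\<Sum>i\<le>N. monom (b i) i) j = (if j \<le> N then b j else 0)" for j
    by (simp add: coeff_sum coeff_monom)
  have "coeff (pcompose p [:t, 1:]) j = 0" if "j > N" for j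
    using that assms by (intro coeff_eq_0) (simp add: degree_pcompose)
  then show ?thesis
    unfolding inj[of p] shift by (auto simp: poly_eq_iff cf)
qed

end

theory Submission
  imports Defs
begin

text \<open>Let f be the Chebyshev polynomial of degree l and F n its n-th iterate. Since f' is l times a
  Chebyshev polynomial u of the second kind, the chain rule makes all coefficients of (F n)'
  divisible by l^n; hence l^n divides i * b i, which gives the lower bound. For the equality,
  expand F (n + 1) = f (F n) around F n (t) in powers of g = F n - F n (t): the lower bound for
  indices below l^m shows that the terms g^2, g^3, ... do not matter for the coefficient at l^m,
  and the linear term has the factor f' (F n (t)) = l * u (F n (t)). Here u (F n (t)) is prime to l
  because F n (t) is congruent to t modulo l, and f^2 - (x^2 - 4) * u^2 = 4 then gives
  u^2 = 1 modulo l at this point.\<close>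

section \<open>Chebyshev polynomials of the second kind and their identities\<close>

text \<open>At \<open>z + 1/z\<close> with z \<noteq> 0, 1, -1 the value is
  \<open>(z^d - z^(-d)) / (z - 1/z)\<close>. The index is thus one more than the usual degree
  convention, so that the derivative in \<open>pderiv_chebyshev_rec\<close> needs no shift.\<close>

fun chebyshev_snd :: "nat \<Rightarrow> int poly" where
  "chebyshev_snd 0 = 0"
| "chebyshev_snd (Suc 0) = 1"
| "chebyshev_snd (Suc (Suc d)) = pCons 0 (chebyshev_snd (Suc d)) - chebyshev_snd d"

lemma chebyshev_rec_eq_snd:
  "chebyshev_rec d = smult 2 (chebyshev_snd (Suc d)) - pCons 0 (chebyshev_snd d)"
proof (induction d rule: chebyshev_rec.induct)
  case (3 d)
  show ?case
    unfolding chebyshev_rec.simps 3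
    by (rule poly_eqI) (simp add: coeff_pCons split: nat.split)
qed (simp_all add: one_pCons)

lemma pderiv_chebyshev_rec:
  "pderiv (chebyshev_rec d) = smult (int d) (chebyshev_snd d)"
proof (induction d rule: chebyshev_rec.induct)
  case (3 d)
  \<comment> \<open>With this form the product rule below collects to (d + 2) times the right-hand
    side of the recurrence for \<open>chebyshev_snd\<close>.\<close>
  have first_kind: "chebyshev_rec (Suc d) =
      pCons 0 (chebyshev_snd (Suc d)) - smult 2 (chebyshev_snd d)"
    unfolding chebyshev_rec_eq_snd
    by (rule poly_eqI) (simp add: coeff_pCons split: nat.split)
  have "pderiv (chebyshev_rec (Suc (Suc d))) = chebyshev_rec (Suc d)
      + pCons 0 (smult (int (Suc d)) (chebyshev_snd (Suc d))) - smult (int d) (chebyshev_snd d)"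
    by (simp only: chebyshev_rec.simps pderiv_diff pderiv_pCons 3)
  also have "\<dots> = smult (int (Suc (Suc d))) (chebyshev_snd (Suc (Suc d)))"
    unfolding first_kind
    by (rule poly_eqI) (simp add: coeff_pCons algebra_simps split: nat.split)
  finally show ?case .
qed (simp_all add: pderiv_pCons one_pCons)

text \<open>The recurrence step (a, b) \<mapsto> (s a - b, a) preserves this quadratic form.\<close>

lemma chebyshev_snd_invariant:
  fixes s :: int and d :: nat
  defines "a \<equiv> poly (chebyshev_snd (Suc d)) s" and "b \<equiv> poly (chebyshev_snd d) s"
  shows "a\<^sup>2 - s * a * b + b\<^sup>2 = 1"
  unfolding a_def b_def
  by (induction d) (simp_all add: power2_eq_square algebra_simps)

text \<open>Writing the first kind as 2a - s b turns the left side into four times the invariant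
  form.\<close>

lemma chebyshev_pell:
  fixes s :: int
  shows "(poly (chebyshev_rec d) s)\<^sup>2 - (s\<^sup>2 - 4) * (poly (chebyshev_snd d) s)\<^sup>2 = 4"
  using chebyshev_snd_invariant[of d s]
  by (simp add: chebyshev_rec_eq_snd power2_eq_square algebra_simps del: chebyshev_snd.simps)

lemma chebyshev_rec_odd_at_0: "odd d \<Longrightarrow> coeff (chebyshev_rec d) 0 = 0"
  by (induction d rule: chebyshev_rec.induct) auto

section \<open>Congruences modulo the prime l\<close>

lemma fermat_nat:
  fixes a :: nat
  assumes "prime l"
  shows "[a ^ l = a] (mod l)"
proof (induction a)
  case 0
  then show ?case using assms prime_gt_0_nat by (simp add: zero_power)
next
  case (Suc a)
  have l: "l > 0" using assms prime_gt_0_nat by blast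
  have "Suc a ^ l = (\<Sum>k\<le>l. (l choose k) * a ^ k)"
    using binomial[of a 1 l] by simp
  also have "{..l} = insert 0 (insert l {0<..<l})"
    by auto
  also have "(\<Sum>k\<in>\<dots>. (l choose k) * a ^ k) = 1 + (a ^ l + (\<Sum>k\<in>{0<..<l}. (l choose k) * a ^ k))"
    using l by simp
  also have "[\<dots> = 1 + (a + 0)] (mod l)"
    using assms Suc
    by (intro cong_add) (auto simp: cong_0_iff intro!: dvd_sum dvd_mult2 dvd_choose_prime)
  finally show ?case by simp
qed

lemma fermat_int:
  fixes s :: int
  assumes "prime l"
  shows "[s ^ l = s] (mod int l)"
proof -
  define a where "a = nat (s mod int l)"
  have "[int a = s] (mod int l)"
    using assms prime_gt_0_nat by (simp add: a_def cong_def)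
  moreover have "[int a ^ l = int a] (mod int l)"
    using fermat_nat[OF assms, of a] by (metis cong_int_iff of_nat_power)
  ultimately show ?thesis by (meson cong_pow cong_sym cong_trans)
qed

text \<open>As polynomials, \<open>chebyshev_rec l\<close> is congruent to \<open>x^l\<close>: for 0
  < j < l the derivative formula makes j times the coefficient at j divisible by l, and the constant
  term vanishes for odd l. Fermat's little theorem does the rest.\<close>

lemma chebyshev_rec_prime_cong:
  fixes s :: int
  assumes "prime l" "odd l"
  shows "[poly (chebyshev_rec l) s = s] (mod int l)"
proof -
  let ?c = "coeff (chebyshev_rec l)"
  have dvd: "int l dvd ?c j" if "j < l" for j
  proof (cases j)
    case 0
    with assms chebyshev_rec_odd_at_0 show ?thesis by simp
  next
    case (Suc k)
    have "int j * ?c j = int l * coeff (chebyshev_snd l) k"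
      using arg_cong[OF pderiv_chebyshev_rec, of "\<lambda>p. coeff p k" l]
      by (simp add: coeff_pderiv Suc)
    then have "int l dvd int j * ?c j" by simp
    moreover have "\<not> int l dvd int j" using that Suc by (auto dest!: dvd_imp_le simp del: of_nat_Suc)
    ultimately show ?thesis using assms by (simp add: prime_dvd_mult_iff)
  qed
  have l: "l > 0" using assms prime_gt_0_nat by blast
  have "poly (chebyshev_rec l) s = (\<Sum>j\<le>l. ?c j * s ^ j)"
    using chebyshev_rec_degree[of l] by (simp add: poly_altdef)
  also have "\<dots> = (\<Sum>j<l. ?c j * s ^ j) + s ^ l"
    using chebyshev_rec_degree[of l] l by (simp add: lessThan_Suc_atMost[symmetric])
  also have "[\<dots> = 0 + s] (mod int l)"
    using dvd fermat_int[OF assms(1)]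
    by (intro cong_add) (auto simp: cong_0_iff intro!: dvd_sum)
  finally show ?thesis by simp
qed

text \<open>Otherwise the Pell identity gives 4 for the square of the first kind at s modulo l; that
  value is congruent to s, so l divides (s - 2)(s + 2).\<close>

lemma chebyshev_snd_prime_not_dvd:
  fixes s :: int
  assumes "prime l" "odd l" "\<not> [s = 2] (mod int l)" "\<not> [s = - 2] (mod int l)"
  shows "\<not> int l dvd poly (chebyshev_snd l) s"
proof
  assume "int l dvd poly (chebyshev_snd l) s"
  then have "int l dvd (s\<^sup>2 - 4) * (poly (chebyshev_snd l) s)\<^sup>2"
    by (simp add: power2_eq_square)
  also have "\<dots> = (poly (chebyshev_rec l) s)\<^sup>2 - 4"
    using chebyshev_pell[of l s] by linarith
  finally have "[(poly (chebyshev_rec l) s)\<^sup>2 = 4] (mod int l)"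
    by (simp add: cong_iff_dvd_diff)
  then have "[s\<^sup>2 = 4] (mod int l)"
    using cong_pow[OF chebyshev_rec_prime_cong[OF assms(1,2)], of s 2]
    by (meson cong_sym cong_trans)
  then have "int l dvd (s - 2) * (s + 2)"
    by (simp add: cong_iff_dvd_diff power2_eq_square algebra_simps)
  with assms show False
    by (simp add: prime_dvd_mult_iff cong_iff_dvd_diff)
qed

section \<open>Divisibility of the coefficients of iterates\<close>

lemma poly_iterate_0 [simp]: "poly_iterate 0 p = [:0, 1:]"
  and poly_iterate_Suc [simp]: "poly_iterate (Suc n) p = pcompose p (poly_iterate n p)"
  by (simp_all add: poly_iterate_def)

lemma pderiv_poly_iterate:
  fixes f u :: "int poly"
  assumes "pderiv f = smult c u"
  shows "\<exists>v. pderiv (poly_iterate n f) = smult (c ^ n) v"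
proof (induction n)
  case (Suc n)
  then obtain v where "pderiv (poly_iterate n f) = smult (c ^ n) v" by blast
  then have "pderiv (poly_iterate (Suc n) f) =
      smult (c ^ Suc n) (pcompose u (poly_iterate n f) * v)"
    by (simp add: pderiv_pcompose assms pcompose_smult mult.commute)
  then show ?case by blast
qed auto

text \<open>Translation by t commutes with differentiation, and i times the coefficient at i is the
  coefficient of the derivative at i - 1.\<close>

lemma power_dvd_coeff_of_pderiv:
  fixes f u :: "int poly"
  assumes "pderiv f = smult c u"
  shows "c ^ n dvd int i * coeff (pcompose (poly_iterate n f) [:t, 1:]) i"
proof (cases i)
  case (Suc k)
  obtain v where v: "pderiv (poly_iterate n f) = smult (c ^ n) v"
    using pderiv_poly_iterate[OF assms] by blast
  have "pderiv (pcompose (poly_iterate n f) [:t, 1:]) = smult (c ^ n) (pcompose v [:t, 1:])"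
    by (simp add: pderiv_pcompose v pcompose_smult pderiv_pCons)
  from arg_cong[OF this, of "\<lambda>p. coeff p k"] show ?thesis
    by (simp add: coeff_pderiv Suc)
qed auto

text \<open>Since \<open>i < l ^ Suc m\<close>, the factor i absorbs at most m of the n factors
  l.\<close>

lemma prime_power_dvd_cancel:
  fixes l i n m :: nat and b :: int
  assumes "prime l" "int l ^ n dvd int i * b" "0 < i" "i < l ^ Suc m"
  shows "int l ^ (n - m) dvd b"
proof (cases "b = 0")
  case False
  have p: "prime (int l)" using assms by simp
  let ?k = "multiplicity (int l) (int i)"
  have "int l ^ ?k dvd int i" by (rule multiplicity_dvd)
  then have "l ^ ?k dvd i" by (metis of_nat_dvd_iff of_nat_power)
  then have "l ^ ?k < l ^ Suc m" using assms by (meson dvd_imp_le le_less_trans)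
  then have k: "?k \<le> m"
    using assms prime_gt_1_nat power_less_imp_less_exp less_Suc_eq_le by blast
  have "n \<le> multiplicity (int l) (int i * b)"
    using assms False p by (intro multiplicity_geI) auto
  also have "\<dots> = ?k + multiplicity (int l) b"
    using assms False p by (intro prime_elem_multiplicity_mult_distrib) auto
  finally show ?thesis using k by (intro multiplicity_dvd') simp
qed simp

lemma dvd_coeff_mult:
  fixes p q :: "int poly"
  assumes "\<And>j. j \<le> k \<Longrightarrow> d dvd coeff p j"
  shows "d dvd coeff (p * q) k"
  unfolding coeff_mult using assms by (intro dvd_sum) auto

text \<open>Even for j = k the coefficient of g at k is harmless: it meets only the vanishing
  constant coefficient.\<close>

lemma dvd_coeff_square:
  fixes g :: "int poly"
  assumes "coeff g 0 = 0" "\<And>j. 0 < j \<Longrightarrow> j < k \<Longrightarrow> d dvd coeff g j" "j \<le> k"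
  shows "d\<^sup>2 dvd coeff (g\<^sup>2) j"
  unfolding power2_eq_square coeff_mult
proof (intro dvd_sum)
  fix a assume "a \<in> {..j}"
  then consider "a = 0" | "a = j" | "0 < a" "a < k" "0 < j - a" "j - a < k"
    using assms(3) by force
  then show "d * d dvd coeff g a * coeff g (j - a)"
    by cases (use assms in \<open>auto intro: mult_dvd_mono\<close>)
qed

text \<open>This bounds the valuation at \<open>l ^ m\<close> from above, by induction on n starting
  from m.\<close>

lemma coeff_iterate_prime_power:
  fixes f u :: "int poly"
  assumes l: "prime l" and f: "lead_coeff f = 1" "degree f = l"
    and u: "pderiv f = smult (int l) u"
    and frob: "\<And>s. [poly f s = s] (mod int l)"
    and unit: "\<And>s. [s = t] (mod int l) \<Longrightarrow> \<not> int l dvd poly u s"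
    and "m \<le> n"
  shows "\<not> int l ^ Suc (n - m) dvd coeff (pcompose (poly_iterate n f) [:t, 1:]) (l ^ m)"
  using \<open>m \<le> n\<close>
proof (induction n rule: nat_induct_at_least)
  case base
  \<comment> \<open>For n = m the index \<open>l ^ m\<close> is the degree, so the coefficient is
    the leading one.\<close>
  let ?F = "pcompose (poly_iterate m f) [:t, 1:]"
  have "lead_coeff (poly_iterate m f) = 1"
    by (induction m) (use f prime_gt_0_nat[OF l] in \<open>simp_all add: lead_coeff_comp degree_poly_iterate\<close>)
  then have "lead_coeff ?F = 1"
    by (simp add: lead_coeff_comp)
  then have "coeff ?F (l ^ m) = 1"
    by (simp add: degree_poly_iterate f degree_pcompose)
  then show ?case using prime_gt_1_nat[OF l] by simp
next
  case (Suc n)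
  \<comment> \<open>G is the n-th iterate recentred at t, s its value at t, and h is f recentred at
    s; the next iterate, recentred at t, is then h(g).\<close>
  define G where "G = pcompose (poly_iterate n f) [:t, 1:]"
  define s where "s = coeff G 0"
  define g where "g = G - [:s:]"
  define h where "h = pcompose f [:s, 1:]"
  obtain c0 c1 r where h: "h = pCons c0 (pCons c1 r)" by (metis pCons_cases)
  have "[s = t] (mod int l)"
  proof -
    have "[poly (poly_iterate n f) t = t] (mod int l)"
      by (induction n) (auto simp: poly_pcompose intro: cong_trans frob)
    moreover have "s = poly (poly_iterate n f) t"
      by (simp add: s_def G_def poly_pcompose flip: poly_0_coeff_0)
    ultimately show ?thesis by simp
  qed
  \<comment> \<open>The linear coefficient of h is the derivative of f at s.\<close>
  have "c1 = coeff (pderiv h) 0" by (simp add: h coeff_pderiv)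
  also have "pderiv h = smult (int l) (pcompose u [:s, 1:])"
    by (simp add: h_def pderiv_pcompose u pcompose_smult pderiv_pCons)
  finally have c1: "c1 = int l * poly u s"
    by (simp add: poly_pcompose flip: poly_0_coeff_0)
  let ?e = "Suc (n - m)" and ?b = "coeff G (l ^ m)"
  have "pcompose (poly_iterate (Suc n) f) [:t, 1:] = pcompose f G"
    by (simp add: G_def pcompose_assoc)
  also have "\<dots> = pcompose h g"
    by (simp add: h_def g_def pcompose_pCons flip: pcompose_assoc)
  also have "\<dots> = [:c0:] + smult c1 g + g\<^sup>2 * pcompose r g"
    by (simp add: h pcompose_pCons power2_eq_square algebra_simps)
  finally have expand: "coeff (pcompose (poly_iterate (Suc n) f) [:t, 1:]) (l ^ m) =
      int l * poly u s * ?b + coeff (g\<^sup>2 * pcompose r g) (l ^ m)"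
    using prime_gt_0_nat[OF l] by (simp add: c1 g_def coeff_pCons split: nat.split)
  have "int l ^ ?e dvd coeff g j" if j: "0 < j" "j < l ^ m" for j
  proof -
    \<comment> \<open>An index j with \<open>0 < j < l ^ m\<close> forces m > 0, and the lower bound
      with m - 1 in place of m yields one more factor l than at \<open>l ^ m\<close>.\<close>
    obtain k where k: "m = Suc k" using j by (cases m) auto
    have "int l ^ (n - k) dvd coeff G j"
      using power_dvd_coeff_of_pderiv[OF u, of n j t] l j
      by (intro prime_power_dvd_cancel[of l n j]) (auto simp: G_def k)
    moreover have "n - k = ?e" using Suc k by simp
    ultimately show ?thesis using j by (simp add: g_def coeff_pCons split: nat.split)
  qed
  then have "(int l ^ ?e)\<^sup>2 dvd coeff (g\<^sup>2 * pcompose r g) (l ^ m)"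
    by (intro dvd_coeff_mult dvd_coeff_square[where k = "l ^ m"]) (auto simp: g_def s_def)
  \<comment> \<open>Here 2e \<ge> e + 1 because e = n - m + 1 is positive.\<close>
  moreover have "int l ^ Suc ?e dvd (int l ^ ?e)\<^sup>2"
    unfolding power_mult[symmetric] by (rule le_imp_power_dvd) simp
  ultimately have sq: "int l ^ Suc ?e dvd coeff (g\<^sup>2 * pcompose r g) (l ^ m)"
    by (rule dvd_trans[rotated])
  have ub: "\<not> int l ^ ?e dvd poly u s * ?b"
  proof
    assume "int l ^ ?e dvd poly u s * ?b"
    moreover have "coprime (int l ^ ?e) (poly u s)"
      using unit[OF \<open>[s = t] (mod int l)\<close>] l by (simp add: prime_imp_coprime)
    ultimately have "int l ^ ?e dvd ?b" by (simp only: coprime_dvd_mult_right_iff)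
    with Suc.IH show False by (simp add: G_def)
  qed
  show ?case
  proof
    assume "int l ^ Suc (Suc n - m) dvd
      coeff (pcompose (poly_iterate (Suc n) f) [:t, 1:]) (l ^ m)"
    \<comment> \<open>The quadratic remainder is removed by \<open>sq\<close>; cancelling one l then
      contradicts \<open>ub\<close>.\<close>
    then have "int l ^ Suc ?e dvd int l * (poly u s * ?b)"
      unfolding expand using sq Suc.hyps
      by (simp add: Suc_diff_le dvd_add_left_iff mult.assoc del: power_Suc)
    with ub show False using prime_gt_0_nat[OF l] by simp
  qed
qed

theorem theorem5p8:
  fixes l n m i :: nat and t :: int and b :: "nat \<Rightarrow> int"
  assumes "prime l" and "odd l" and "n > 0"
    and "\<not> [t = 0] (mod int l)"
    and "\<not> [t = 2] (mod int l)" and "\<not> [t = - 2] (mod int l)"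
    and "poly_iterate n (chebyshev l) - [:t:] = (\<Sum>i\<le>l ^ n. smult (b i) ([:- t, 1:] ^ i))"
    and "l ^ m \<le> i" and "i < l ^ (m + 1)" and "l ^ (m + 1) \<le> l ^ n"
  shows "valuation l (b i) \<ge> enat (n - m)
    \<and> (i = l ^ m \<longrightarrow> valuation l (b i) = enat (n - m))"
proof -
  let ?f = "chebyshev_rec l"
  have l: "1 < l" using assms(1) prime_gt_1_nat by blast
  have f: "chebyshev l = ?f" using l by (simp add: chebyshev_eq_rec)
  have deg: "degree ?f = l" and lead: "lead_coeff ?f = 1"
    using chebyshev_rec_degree[of l] l by simp_all
  have i: "0 < i" "i \<le> l ^ n"
    using assms(8-10) l by (auto intro: less_le_trans[of 0 "l ^ m"])
  have "degree (poly_iterate n ?f - [:t:]) \<le> l ^ n"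
    by (intro degree_diff_le) (simp_all add: degree_poly_iterate deg)
  \<comment> \<open>Subtracting the constant t affects only the coefficient at 0, while i >
    0.\<close>
  from expansion_iff[OF this, where t = t and b = b] assms(7) i
  have b: "b i = coeff (pcompose (poly_iterate n ?f) [:t, 1:]) i"
    by (simp add: f pcompose_diff coeff_pCons split: nat.split)
  have lower: "int l ^ (n - m) dvd b i"
    using power_dvd_coeff_of_pderiv[OF pderiv_chebyshev_rec, of l n i t] assms(1,9) i
    by (intro prime_power_dvd_cancel[of l n i]) (simp_all add: b)
  have "enat (n - m) \<le> valuation l (b i)"
    using lower l by (auto simp: valuation_def intro!: multiplicity_geI)
  moreover have "valuation l (b i) = enat (n - m)" if "i = l ^ m"
  proof -
    have mn: "m \<le> n" using power_le_imp_le_exp[OF l assms(10)] by linarith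
    have unit: "\<not> int l dvd poly (chebyshev_snd l) s" if "[s = t] (mod int l)" for s
      using that assms(1,2,5,6) by (intro chebyshev_snd_prime_not_dvd) (auto dest: cong_trans cong_sym)
    have "\<not> int l ^ Suc (n - m) dvd b i"
      unfolding b unfolding that
      by (rule coeff_iterate_prime_power[OF assms(1) lead deg pderiv_chebyshev_rec
            chebyshev_rec_prime_cong[OF assms(1,2)] unit mn])
    \<comment> \<open>This excludes the infinite value of \<open>valuation\<close>.\<close>
    moreover from this have "b i \<noteq> 0" by auto
    ultimately show ?thesis using lower by (simp add: valuation_def multiplicity_eqI)
  qed
  ultimately show ?thesis by blast
qed

end
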